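(* Let $\tau\in\mathbb{C}$ with $\operatorname{Im}\tau>0$ and let $n\ge2$ be an integer. Then $$\theta_1(nz|n\tau)=\frac{n\,\theta_1'(0|n\tau)}{\theta_1'(0|\tau)\prod_{k=1}^{n-1}\theta_1\!\left(\frac{k\pi}{n}\,\big|\,\tau\right)}\prod_{k=0}^{n-1}\theta_1\!\left(z+\frac{k\pi}{n}\,\Big|\,\tau\right).$$
   Context: For $\operatorname{Im}\tau>0$ and $q=e^{i\pi\tau}$ (with $q^s$ meaning $e^{i\pi\tau s}$), $$\theta_1(z|\tau)=2\sum_{m=0}^\infty(-1)^mq^{(m+1/2)^2}\sin((2m+1)z),$$ an entire function of $z$; $\theta_1'(0|\tau)$ denotes its derivative in $z$ at $z=0$. *)

theory Defs
  imports "HOL-Analysis.Analysis"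
begin

text \<open>
  The power \<open>q\<^sup>s\<close> of the nome \<open>q = exp (\<i> \<pi> \<tau>)\<close> is read as \<open>exp (\<i> \<pi> \<tau> s)\<close>, which is not in general
  the principal value of the power of the complex number \<open>q\<close>.
\<close>

definition nome_power :: "complex \<Rightarrow> complex \<Rightarrow> complex" where
  "nome_power \<tau> s = exp (\<i> * of_real pi * \<tau> * s)"

text \<open>The series converges absolutely for \<open>Im \<tau> > 0\<close>; other values of \<open>\<tau>\<close> carry no meaning.\<close>

definition theta1 :: "complex \<Rightarrow> complex \<Rightarrow> complex" where
  "theta1 z \<tau> =
     2 * (\<Sum>m. (-1) ^ m * nome_power \<tau> ((of_nat m + 1 / 2)\<^sup>2) * sin ((2 * of_nat m + 1) * z))"

definition theta1_deriv0 :: "complex \<Rightarrow> complex" where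
  "theta1_deriv0 \<tau> = deriv (\<lambda>z. theta1 z \<tau>) 0"

end

theory Submission
  imports Defs
begin

text \<open>
  Put \<open>p = exp (2 \<pi> \<i> \<tau>)\<close>. A finite form of the Jacobi triple product, proved by induction on
  the number of factors, and Tannery's theorem show that the product of \<open>sin z\<close> and the factors \<open>1
  - 2 p ^ j cos (2 z) + p ^ (2 j)\<close>, \<open>1 \<le> j \<le> N\<close>, tends for \<open>N \<rightarrow>
  \<infinity>\<close> to a nonzero multiple of \<open>theta1 z \<tau>\<close>. Replacing \<open>\<tau>\<close> by
  \<open>n \<tau>\<close> replaces \<open>p\<close> by \<open>p ^ n\<close>, and since \<open>\<Prod>k<n. (x - y
  \<omega>\<^sup>k) = x\<^sup>n - y\<^sup>n\<close> for \<open>\<omega> = exp (2 \<pi> \<i> / n)\<close>, each factor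
  at \<open>(n z, p ^ n)\<close> is proportional to the product of the factors at \<open>(z + k \<pi> / n, p)\<close>.
  Hence both sides of the theorem are proportional, and comparing derivatives at \<open>z = 0\<close> determines the
  constant. The product also shows that the denominator does not vanish.
\<close>

section \<open>Factorization over the roots of unity\<close>

text \<open>For \<open>y = 1\<close> both sides are polynomials in \<open>x\<close> of degree at
  most \<open>n\<close> with the same coefficient at \<open>n\<close>, and they agree at the
  \<open>n\<close> distinct roots of unity. Substituting \<open>x / y\<close> and multiplying by
  \<open>y ^ n\<close> gives the homogeneous form.\<close>

lemma prod_minus_roots_unity:
  fixes x y :: complex
  assumes "n > 0"
  shows "(\<Prod>k<n. x - y * exp (2 * of_real pi * \<i> * of_nat k / of_nat n)) = x ^ n - y ^ n"
proof (cases "y = 0")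
  case True
  then show ?thesis using assms by simp
next
  case False
  define w where "w k = exp (2 * of_real pi * \<i> * of_nat k / of_nat n)" for k
  have inj: "inj_on w {..<n}"
    using complex_root_unity_eq[of n] assms
    unfolding w_def inj_on_def cong_def by auto
  have root: "w k ^ n = 1" for k
    using complex_root_unity[of n k] assms by (simp add: w_def)
  let ?P = "(\<Prod>k<n. [:- w k, 1:])" and ?Q = "monom 1 n - 1 :: complex poly"
  have "?P = ?Q"
  proof (rule poly_eqI_degree_lead_coeff[where n = n and A = "w ` {..<n}"])
    show "degree ?P \<le> n"
      by (rule order.trans[OF degree_prod_sum_le]) auto
    show "degree ?Q \<le> n"
      by (intro degree_diff_le) (auto simp: degree_monom_eq)
    have "degree ?P = n" by (subst degree_prod_eq_sum_degree) auto
    moreover have "lead_coeff ?P = 1" by (simp add: lead_coeff_prod)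
    ultimately show "coeff ?P n = coeff ?Q n" using assms by simp
    show "card (w ` {..<n}) \<ge> n" using inj by (simp add: card_image)
    show "poly ?P u = poly ?Q u" if "u \<in> w ` {..<n}" for u
      using that root by (auto simp: poly_prod poly_monom prod_zero_iff)
  qed
  then have "(\<Prod>k<n. x / y - w k) = (x / y) ^ n - 1"
    by (auto simp: poly_prod poly_monom dest!: arg_cong[where f = "\<lambda>p. poly p (x / y)"])
  moreover have "x - y * w k = y * (x / y - w k)" for k
    using False by (simp add: field_simps)
  ultimately have "(\<Prod>k<n. x - y * w k) = y ^ n * ((x / y) ^ n - 1)"
    by (simp add: prod.distrib)
  also have "\<dots> = x ^ n - y ^ n"
    using False by (simp add: power_divide right_diff_distrib)
  finally show ?thesis by (simp add: w_def)
qed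

subsection \<open>The finite triple product\<close>

text \<open>The finite q-Pochhammer symbol \<open>(p; p)_N\<close>.\<close>

definition qpoch :: "complex \<Rightarrow> nat \<Rightarrow> complex" where
  "qpoch p N = (\<Prod>j<N. 1 - p ^ Suc j)"

lemma qpoch_0 [simp]: "qpoch p 0 = 1"
  and qpoch_Suc [simp]: "qpoch p (Suc N) = qpoch p N * (1 - p ^ Suc N)"
  by (simp_all add: qpoch_def)

lemma one_minus_power_nonzero:
  fixes p :: complex
  assumes "norm p < 1"
  shows "1 - p ^ Suc j \<noteq> 0"
proof
  assume "1 - p ^ Suc j = 0"
  then have "norm p ^ Suc j = 1" by (metis eq_iff_diff_eq_0 norm_one norm_power)
  then show False
    using assms by (metis less_irrefl norm_ge_zero power_less_one_iff zero_less_Suc)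
qed

lemma qpoch_nonzero: "norm p < 1 \<Longrightarrow> qpoch p N \<noteq> 0"
  using one_minus_power_nonzero[of p] unfolding qpoch_def by (simp add: prod_zero_iff)

text \<open>
  With the triangular number \<open>\<Sum>{..m} = m (m + 1) / 2\<close> these are the coefficients of the finite
  triple product in its \<open>sin ((2 m + 1) z)\<close> expansion, the Gaussian binomials
  \<open>[2 N + 1 choose N - m]\<close> up to sign and a power of \<open>p\<close>.
\<close>

definition theta_coeff :: "complex \<Rightarrow> nat \<Rightarrow> nat \<Rightarrow> complex" where
  "theta_coeff p N m = (if m \<le> N
     then (-1) ^ m * p ^ (\<Sum>{..m}) * qpoch p (2 * N + 1) / (qpoch p (N - m) * qpoch p (N + m + 1))
     else 0)"

text \<open>One more factor \<open>1 - p ^ Suc N * t + p ^ (2 * Suc N)\<close> enters the product,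
  and multiplication by \<open>t\<close> shifts coefficients one index up and one index down. The
  value \<open>- theta_coeff p N 0\<close> stands for the coefficient at index -1, because
  \<open>sin ((2 m + 1) z)\<close> changes sign under \<open>m -> -1 - m\<close>.\<close>

lemma theta_coeff_Suc:
  assumes p: "norm p < 1"
  shows "theta_coeff p (Suc N) m = (1 + p ^ (2 * Suc N)) * theta_coeff p N m
    - p ^ Suc N * ((if m = 0 then - theta_coeff p N 0 else theta_coeff p N (m - 1))
                   + theta_coeff p N (Suc m))"
proof -
  note nz = qpoch_nonzero[OF p] one_minus_power_nonzero[OF p]
  \<comment> \<open>This is the recurrence divided by \<open>theta_coeff p N m\<close>, with
    \<open>u = p ^ (N - m)\<close> and \<open>v = p ^ (N + m + 1)\<close>.\<close>
  have key: "(1 - p * u * v) * (1 - p * p * u * v) / ((1-p * u)*(1-p * v))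
      = (1 + p * u * v) + p * u * (1-v)/(1-p * u) + p * v * (1-u)/(1-p * v)"
    if "1 - p * u \<noteq> 0" "1 - p * v \<noteq> 0" for u v
    using that by (simp add: divide_simps) algebra
  consider "m > Suc N" | "m = Suc N" | "m \<le> N" by linarith
  then show ?thesis
  proof cases
    case 1
    then show ?thesis by (simp add: theta_coeff_def)
  next
    \<comment> \<open>The new top coefficient comes only from the upward shift of the old
      one.\<close>
    case 2
    have "theta_coeff p (Suc N) m = (-1) ^ Suc N * p ^ (\<Sum>{..Suc N})"
      using nz(1)[of "2 * Suc N + 1"] 2 by (simp add: theta_coeff_def mult_2 del: qpoch_Suc)
    moreover have "theta_coeff p N (m - 1) = (-1) ^ N * p ^ (\<Sum>{..N})"
      using nz(1)[of "2 * N + 1"] 2 by (simp add: theta_coeff_def mult_2 del: qpoch_Suc)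
    moreover have "theta_coeff p N m = 0" "theta_coeff p N (Suc m) = 0"
      using 2 by (simp_all add: theta_coeff_def)
    ultimately show ?thesis using 2 by (simp add: power_add)
  next
    case 3
    define u v where "u = p ^ (N - m)" and "v = p ^ (N + m + 1)"
    define c where "c = theta_coeff p N m"
    define E where "E = (-1) ^ m * p ^ (\<Sum>{..m})"
    have pu: "1 - p * u \<noteq> 0" using nz(2)[of "N - m"] by (simp add: u_def)
    have pv: "1 - p * v \<noteq> 0" using nz(2)[of "N + m + 1"] by (simp add: v_def)
    have c: "c = E * qpoch p (2 * N + 1) / (qpoch p (N - m) * qpoch p (N + m + 1))"
      using 3 by (simp add: c_def E_def theta_coeff_def)
    have uv: "u * v = p ^ (2 * N + 1)"
      using 3 by (simp add: u_def v_def mult_2 flip: power_add power_Suc)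
    have qu: "qpoch p (Suc N - m) = qpoch p (N - m) * (1 - p * u)"
      using 3 by (simp add: Suc_diff_le u_def)
    have qv: "qpoch p (Suc N + m + 1) = qpoch p (N + m + 1) * (1 - p * v)"
      by (simp add: v_def)
    have quv: "qpoch p (2 * Suc N + 1) = qpoch p (2 * N + 1) * ((1 - p * u * v) * (1 - p * p * u * v))"
    proof -
      have "p * u * v = p ^ Suc (2 * N + 1)" "p * p * u * v = p ^ Suc (Suc (2 * N + 1))"
        using uv by (simp_all only: mult.assoc power_Suc)
      moreover have "2 * Suc N + 1 = Suc (Suc (2 * N + 1))" by simp
      ultimately show ?thesis by (simp only: qpoch_Suc mult.assoc)
    qed
    have new: "theta_coeff p (Suc N) m = c * ((1 - p * u * v) * (1 - p * p * u * v) / ((1-p * u)*(1-p * v)))"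
      using 3 unfolding c theta_coeff_def qu qv quv E_def by (simp add: mult_ac del: qpoch_Suc)
    have up: "p ^ Suc N * theta_coeff p N (Suc m) = - c * (p * v * (1-u)/(1-p * v))"
    proof (cases "m = N")
      \<comment> \<open>Here \<open>u = 1\<close>, so the factor \<open>1 - u\<close> reproduces the
        vanishing of the coefficient beyond \<open>N\<close>.\<close>
      case True
      then show ?thesis by (simp add: theta_coeff_def u_def)
    next
      case False
      then have "Suc m \<le> N" using 3 by simp
      have q: "qpoch p (N - m) = qpoch p (N - Suc m) * (1 - u)"
        using \<open>Suc m \<le> N\<close> unfolding u_def 
        by (metis Suc_diff_Suc Suc_le_lessD qpoch_Suc)
      have u1: "1 - u \<noteq> 0"
        using \<open>Suc m \<le> N\<close> nz(2)[of "N - Suc m"] by (simp add: u_def Suc_diff_Suc del: power_Suc)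
      have pw: "p ^ Suc N * ((-1) ^ Suc m * p ^ (\<Sum>{..Suc m})) = - E * (p * v)"
        by (simp add: E_def v_def power_add)
      have "p ^ Suc N * theta_coeff p N (Suc m)
         = (p ^ Suc N * ((-1) ^ Suc m * p ^ (\<Sum>{..Suc m}))) * qpoch p (2 * N + 1)
            / (qpoch p (N - Suc m) * (qpoch p (N + m + 1) * (1 - p * v)))"
        using \<open>Suc m \<le> N\<close> by (simp add: theta_coeff_def v_def)
      also have "\<dots> = - c * (p * v * (1-u)/(1-p * v))"
        unfolding pw c q using u1 by (simp add: mult_ac del: qpoch_Suc)
      finally show ?thesis .
    qed
    have down: "p ^ Suc N * (if m = 0 then - theta_coeff p N 0 else theta_coeff p N (m - 1))
        = - c * (p * u * (1-v)/(1-p * u))"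
    proof (cases m)
      case 0
      \<comment> \<open>The fraction \<open>(1 - v) / (1 - p * u)\<close> therefore equals 1, and
        the boundary term fits the general formula.\<close>
      have "v = p * u" using 0 by (simp add: u_def v_def)
      then show ?thesis using pu 0 by (simp add: c_def u_def)
    next
      case (Suc k)
      have q: "qpoch p (N + m + 1) = qpoch p (N + k + 1) * (1 - v)"
        by (simp add: v_def Suc)
      have v1: "1 - v \<noteq> 0"
        using nz(2)[of "N + m"] by (simp add: v_def)
      have Nk: "qpoch p (N - k) = qpoch p (N - m) * (1 - p * u)"
        using qu Suc by simp
      have "Suc N = m + Suc (N - m)" using 3 by simp
      then have "p ^ Suc N = p ^ m * (p * u)"
        unfolding u_def by (metis power_Suc power_add)
      then have pw: "p ^ Suc N * ((-1) ^ k * p ^ (\<Sum>{..k})) = - E * (p * u)"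
        by (simp only: E_def Suc power_add sum.atMost_Suc power_Suc) (simp add: mult_ac)
      have "p ^ Suc N * theta_coeff p N k
         = (p ^ Suc N * ((-1) ^ k * p ^ (\<Sum>{..k}))) * qpoch p (2 * N + 1)
            / (qpoch p (N - m) * (1 - p * u) * qpoch p (N + k + 1))"
        using 3 Suc Nk by (simp add: theta_coeff_def)
      also have "\<dots> = - c * (p * u * (1-v)/(1-p * u))"
        unfolding pw c q using v1 by (simp add: mult_ac del: qpoch_Suc)
      finally show ?thesis using Suc by simp
    qed
    have sq: "p ^ (2 * Suc N) = p * u * v"
      using uv by (simp add: mult.assoc)
    have "c * (x + y + z) = x * c - (- c * y + - c * z)" for x y z by algebra
    then show ?thesis
      unfolding distrib_left[of "p ^ Suc N"] up down new sq key[OF pu pv] c_def[symmetric]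
      by (simp only:)
  qed
qed

text \<open>The recurrence is moved from \<open>s\<close> to the coefficients by shifting indices;
  its initial case amounts to setting \<open>s\<close> to \<open>- s 0\<close> at index -1, which
  produces the coefficient \<open>- a 0\<close>.\<close>

lemma three_term_sum:
  fixes a s :: "nat \<Rightarrow> 'a::comm_ring_1"
  assumes "t * s 0 = s 1 - s 0" "\<And>m. t * s (Suc m) = s (Suc (Suc m)) + s m"
  shows "t * (\<Sum>m\<le>N. a m * s m) =
    (\<Sum>m\<le>Suc N. (if m = 0 then - a 0 else a (m - 1)) * s m) + (\<Sum>m<N. a (Suc m) * s m)"
proof (induction N)
  case 0
  have "t * (a 0 * s 0) = a 0 * (t * s 0)" by (simp add: mult_ac)
  then show ?case using assms(1) by (simp add: algebra_simps)
next
  case (Suc N)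
  have "t * (a (Suc N) * s (Suc N)) = a (Suc N) * (t * s (Suc N))" by (simp add: mult_ac)
  then show ?case
    unfolding sum.atMost_Suc[of _ N] distrib_left Suc.IH assms(2)
    by (simp add: algebra_simps)
qed

text \<open>
  The recurrence for \<open>s\<close> is met by \<open>s m = sin ((2 m + 1) z)\<close> with \<open>t = 2 cos (2 z)\<close>, and, in the limit
  \<open>z \<rightarrow> 0\<close>, by \<open>s m = 2 m + 1\<close> with \<open>t = 2\<close>; the latter gives the derivative at \<open>0\<close>.
\<close>

lemma finite_triple_product:
  fixes s :: "nat \<Rightarrow> complex"
  assumes p: "norm p < 1"
  assumes s: "t * s 0 = s 1 - s 0" "\<And>m. t * s (Suc m) = s (Suc (Suc m)) + s m"
  shows "s 0 * (\<Prod>j<N. 1 - p ^ Suc j * t + p ^ (2 * Suc j)) = (\<Sum>m\<le>N. theta_coeff p N m * s m)"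
proof (induction N)
  case 0
  show ?case using one_minus_power_nonzero[OF p, of 0] by (simp add: theta_coeff_def)
next
  case (Suc N)
  let ?a = "theta_coeff p N"
  have z: "?a m = 0" if "m > N" for m using that by (simp add: theta_coeff_def)
  \<comment> \<open>Coefficients beyond \<open>N\<close> vanish, so all sums can be brought to the
    common range \<open>m \<le> Suc N\<close> and compared termwise.\<close>
  have 1: "(\<Sum>m<N. ?a (Suc m) * s m) = (\<Sum>m\<le>Suc N. ?a (Suc m) * s m)"
    using z by (simp flip: lessThan_Suc_atMost)
  have 2: "(\<Sum>m\<le>N. ?a m * s m) = (\<Sum>m\<le>Suc N. ?a m * s m)"
    using z by simp
  let ?S = "\<Sum>m\<le>N. ?a m * s m"
  have "s 0 * (\<Prod>j<Suc N. 1 - p ^ Suc j * t + p ^ (2 * Suc j))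
      = (1 + p ^ (2 * Suc N)) * ?S - p ^ Suc N * (t * ?S)"
    by (simp only: prod.lessThan_Suc mult.assoc[symmetric] Suc.IH) (simp add: algebra_simps)
  also have "\<dots> = (\<Sum>m\<le>Suc N. theta_coeff p (Suc N) m * s m)"
    unfolding three_term_sum[of t s, OF s] 1 unfolding 2 theta_coeff_Suc[OF p] 
    by (simp only: sum_distrib_left sum.distrib[symmetric] sum_subtractf[symmetric])
       (intro sum.cong refl, simp only: algebra_simps)
  finally show ?case .
qed

subsection \<open>Passage to the limit\<close>

lemma nonzero_prod_limit:
  fixes f :: "nat \<Rightarrow> complex"
  assumes "summable (\<lambda>k. norm (f k))" "\<And>k. 1 + f k \<noteq> 0"
  obtains L where "L \<noteq> 0" "(\<lambda>N. \<Prod>k<N. 1 + f k) \<longlonglongrightarrow> L"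
proof
  have "f k \<noteq> -1" for k using assms(2)[of k] by auto
  then have c: "convergent_prod (\<lambda>k. 1 + f k)"
    using assms(1) by (intro summable_imp_convergent_prod_complex) auto
  show "prodinf (\<lambda>k. 1 + f k) \<noteq> 0"
    by (rule prodinf_nonzero[OF c assms(2)])
  show "(\<lambda>N. \<Prod>k<N. 1 + f k) \<longlonglongrightarrow> prodinf (\<lambda>k. 1 + f k)"
    using convergent_prod_LIMSEQ[OF c] unfolding lessThan_Suc_atMost[symmetric]
    by (rule filterlim_sequentially_Suc[THEN iffD1])
qed

text \<open>The case \<open>w = 1\<close> gives the limit of \<open>qpoch\<close>; the cases
  \<open>w = exp (2 i x)\<close> and \<open>w = exp (- 2 i x)\<close> with real \<open>x\<close>
  give the cosine factors.\<close>

lemma prod_one_minus_power_limit_nonzero: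
  fixes p w :: complex
  assumes p: "norm p < 1" and w: "norm w = 1"
  obtains L where "L \<noteq> 0" "(\<lambda>N. \<Prod>j<N. 1 - p ^ Suc j * w) \<longlonglongrightarrow> L"
proof -
  have "summable (\<lambda>k. norm (- (p ^ Suc k * w)))"
    using p w by (simp add: norm_mult norm_power summable_mult summable_geometric)
  moreover have "1 + - (p ^ Suc k * w) \<noteq> 0" for k
  proof
    assume "1 + - (p ^ Suc k * w) = 0"
    then have "p ^ Suc k * w = 1" by simp
    then have "norm p ^ Suc k = 1" using w by (metis mult.right_neutral norm_mult norm_one norm_power)
    then show False using p by (metis less_irrefl norm_ge_zero power_less_one_iff zero_less_Suc)
  qed
  ultimately obtain L where "L \<noteq> 0" "(\<lambda>N. \<Prod>k<N. 1 + - (p ^ Suc k * w)) \<longlonglongrightarrow> L"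
    by (rule nonzero_prod_limit)
  then show ?thesis using that by simp
qed

text \<open>Splitting into two linear factors reduces both convergence and the product over shifted
  arguments to exponentials.\<close>

lemma power_one_minus_cos:
  "1 - a * (2 * cos (2 * z)) + a ^ 2 = (1 - a * exp (2 * \<i> * z)) * (1 - a * exp (- (2 * \<i> * z)))"
  for a z :: complex
proof -
  have "2 * cos (2 * z) = exp (2 * \<i> * z) + exp (- (2 * \<i> * z))"
    by (simp add: cos_exp_eq mult_ac)
  moreover have "exp (2 * \<i> * z) * exp (- (2 * \<i> * z)) = 1"
    by (simp flip: exp_add)
  ultimately show ?thesis by algebra
qed

text \<open>The quadratic exponent \<open>m (m + 1) / 2\<close> beats the exponential. The factor
  \<open>2 m + 1\<close> lets one majorant serve both the series and its derivative.\<close>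

lemma summable_theta_majorant:
  fixes r R :: real
  assumes "0 \<le> r" "r < 1"
  shows "summable (\<lambda>m. r ^ (\<Sum>{..m}) * ((2 * real m + 1) * exp ((2 * real m + 1) * R)))"
    (is "summable ?f")
proof -
  \<comment> \<open>The ratio of consecutive terms is
    \<open>r ^ Suc m * exp (2 * R) * (2 m + 3) / (2 m + 1)\<close>, and the last quotient is at most
    3.\<close>
  have "(\<lambda>m. r ^ Suc m * (3 * exp (2 * R))) \<longlonglongrightarrow> 0 * (3 * exp (2 * R))"
    using assms by (intro tendsto_intros LIMSEQ_Suc LIMSEQ_realpow_zero)
  then have "\<forall>\<^sub>F m in sequentially. r ^ Suc m * (3 * exp (2 * R)) < 1 / 2"
    by (rule order_tendstoD) simp
  then obtain M where M: "\<And>m. m \<ge> M \<Longrightarrow> r ^ Suc m * (3 * exp (2 * R)) < 1 / 2"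
    by (auto simp: eventually_sequentially)
  show ?thesis
  proof (rule summable_ratio_test)
    show "(1/2 :: real) < 1" by simp
    fix m assume "m \<ge> M"
    have e: "exp ((2 * real (Suc m) + 1) * R) = exp ((2 * real m + 1) * R) * exp (2 * R)"
      by (simp add: algebra_simps flip: exp_add)
    have "?f (Suc m) = r ^ (\<Sum>{..m}) * exp ((2 * real m + 1) * R) * (r ^ Suc m * exp (2 * R)) * (2 * real m + 3)"
      unfolding e sum.atMost_Suc power_add by (simp add: algebra_simps)
    also have "\<dots> \<le> r ^ (\<Sum>{..m}) * exp ((2 * real m + 1) * R) * (r ^ Suc m * exp (2 * R)) * (3 * (2 * real m + 1))"
      using assms by (intro mult_left_mono) auto
    also have "\<dots> = (r ^ Suc m * (3 * exp (2 * R))) * ?f m" by (simp add: algebra_simps)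
    also have "\<dots> \<le> 1 / 2 * ?f m"
      using assms M[OF \<open>m \<ge> M\<close>] by (intro mult_right_mono) auto
    finally show "norm (?f (Suc m)) \<le> 1 / 2 * norm (?f m)"
      using assms by simp
  qed
qed

text \<open>Since \<open>qpoch p\<close> has a nonzero limit, it and its inverse are bounded. The
  bound is uniform in \<open>N\<close>, as Tannery's theorem demands.\<close>

lemma theta_coeff_bound:
  assumes p: "norm p < 1"
  obtains B where "\<And>N m. norm (theta_coeff p N m) \<le> B * norm p ^ (\<Sum>{..m})"
proof -
  obtain K where K: "K \<noteq> 0" "qpoch p \<longlonglongrightarrow> K"
    using prod_one_minus_power_limit_nonzero[OF p norm_one] unfolding qpoch_def by auto
  obtain B where B: "\<And>N. norm (qpoch p N) \<le> B"
    using convergent_imp_Bseq[OF convergentI[OF K(2)]] by (auto simp: Bseq_def)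
  obtain D where D: "D > 0" "\<And>N. norm (inverse (qpoch p N)) \<le> D"
    using convergent_imp_Bseq[OF convergentI[OF tendsto_inverse[OF K(2,1)]]] by (auto simp: Bseq_def)
  have "B \<ge> 0" using B[of 0] by simp
  show thesis
  proof (rule that[of "B * (D * D)"])
    fix N m
    show "norm (theta_coeff p N m) \<le> B * (D * D) * norm p ^ (\<Sum>{..m})"
    proof (cases "m \<le> N")
      case True
      then have "norm (theta_coeff p N m) = norm p ^ (\<Sum>{..m}) * (norm (qpoch p (2 * N + 1)) *
         (norm (inverse (qpoch p (N - m))) * norm (inverse (qpoch p (N + m + 1)))))"
        by (simp only: theta_coeff_def if_True norm_mult norm_divide norm_power norm_minus_cancel
              norm_one norm_inverse power_one divide_inverse inverse_mult_distrib mult_1_left mult.assoc)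
      also have "\<dots> \<le> norm p ^ (\<Sum>{..m}) * (B * (D * D))"
        using B D \<open>B \<ge> 0\<close> less_imp_le[OF D(1)] by (intro mult_left_mono mult_mono) (auto simp del: qpoch_Suc)
      finally show ?thesis by (simp add: mult_ac)
    next
      case False
      then show ?thesis using \<open>B \<ge> 0\<close> D(1) by (simp add: theta_coeff_def)
    qed
  qed
qed

text \<open>All three \<open>qpoch\<close> indices tend to infinity, leaving
  \<open>K / (K * K)\<close>.\<close>

lemma theta_coeff_limit:
  assumes p: "norm p < 1" and K: "K \<noteq> 0" "qpoch p \<longlonglongrightarrow> K"
  shows "(\<lambda>N. theta_coeff p N m) \<longlonglongrightarrow> (-1) ^ m * p ^ (\<Sum>{..m}) / K"
proof -
  have 1: "(\<lambda>N. qpoch p (2 * N + 1)) \<longlonglongrightarrow> K"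
    by (rule filterlim_compose[OF K(2)], rule filterlim_subseq) (simp add: strict_mono_def)
  have 2: "(\<lambda>N. qpoch p (N + m + 1)) \<longlonglongrightarrow> K"
    by (rule filterlim_compose[OF K(2)], rule filterlim_subseq) (simp add: strict_mono_def)
  have 3: "(\<lambda>N. qpoch p (N - m)) \<longlonglongrightarrow> K"
    by (rule filterlim_compose[OF K(2)]) (rule filterlim_minus_const_nat_at_top)
  have "(\<lambda>N. (-1) ^ m * p ^ (\<Sum>{..m}) * qpoch p (2 * N + 1) / (qpoch p (N - m) * qpoch p (N + m + 1)))
      \<longlonglongrightarrow> (-1) ^ m * p ^ (\<Sum>{..m}) * K / (K * K)"
    using K(1) by (intro tendsto_intros 1 2 3) auto
  moreover have "\<forall>\<^sub>F N in sequentially. theta_coeff p N m =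
     (-1) ^ m * p ^ (\<Sum>{..m}) * qpoch p (2 * N + 1) / (qpoch p (N - m) * qpoch p (N + m + 1))"
    using eventually_ge_at_top[of m] by eventually_elim (simp add: theta_coeff_def)
  ultimately show ?thesis using K(1) by (simp add: tendsto_cong)
qed

text \<open>Tannery's theorem applied to the finite identity. The constant \<open>K\<close> depends
  on \<open>p\<close> alone, so the proportionality factor is the same for every sequence
  \<open>s\<close>.\<close>

lemma triple_product_limit:
  fixes s :: "nat \<Rightarrow> complex"
  assumes p: "norm p < 1" and K: "K \<noteq> 0" "qpoch p \<longlonglongrightarrow> K"
  assumes s: "t * s 0 = s 1 - s 0" "\<And>m. t * s (Suc m) = s (Suc (Suc m)) + s m"
  assumes bound: "\<And>m. norm (s m) \<le> (2 * real m + 1) * exp ((2 * real m + 1) * R)"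
  shows "(\<lambda>N. s 0 * (\<Prod>j<N. 1 - p ^ Suc j * t + p ^ (2 * Suc j)))
           \<longlonglongrightarrow> (\<Sum>m. (-1) ^ m * p ^ (\<Sum>{..m}) * s m) / K"
proof -
  obtain B where B: "\<And>N m. norm (theta_coeff p N m) \<le> B * norm p ^ (\<Sum>{..m})"
    using theta_coeff_bound[OF p] by blast
  let ?M = "\<lambda>m. norm p ^ (\<Sum>{..m}) * ((2 * real m + 1) * exp ((2 * real m + 1) * R))"
  have M: "summable ?M"
    using p by (intro summable_theta_majorant) auto
  have s': "summable (\<lambda>m. (-1) ^ m * p ^ (\<Sum>{..m}) * s m)"
    by (rule summable_comparison_test'[OF M, of 0])
       (auto simp: norm_mult norm_power intro!: mult_left_mono bound)
  have "norm (theta_coeff p N m * s m) \<le> B * ?M m" for N m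
    using mult_mono[OF B bound order.trans[OF norm_ge_zero B] norm_ge_zero]
    by (simp add: norm_mult mult.assoc)
  then have "(\<lambda>N. \<Sum>m. theta_coeff p N m * s m)
      \<longlonglongrightarrow> (\<Sum>m. (-1) ^ m * p ^ (\<Sum>{..m}) / K * s m)"
    by (intro tannerys_theorem[where M = "\<lambda>m. B * ?M m", THEN conjunct2, THEN conjunct2]
          tendsto_intros theta_coeff_limit[OF p K] summable_mult M)
       (auto simp: case_prod_unfold)
  moreover have "(\<Sum>m. (-1) ^ m * p ^ (\<Sum>{..m}) / K * s m) = (\<Sum>m. (-1) ^ m * p ^ (\<Sum>{..m}) * s m) / K"
    using suminf_divide[OF s', of K] by simp
  \<comment> \<open>Coefficients are zero for \<open>m > N\<close>, so this series is the finite
    sum.\<close>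
  moreover have "(\<Sum>m. theta_coeff p N m * s m) = s 0 * (\<Prod>j<N. 1 - p ^ Suc j * t + p ^ (2 * Suc j))" for N
    unfolding finite_triple_product[OF p s]
    by (rule suminf_finite) (auto simp: theta_coeff_def)
  ultimately show ?thesis by simp
qed

subsection \<open>The product expansion of theta1\<close>

lemma norm_nome_less_1: "Im \<tau> > 0 \<Longrightarrow> norm (nome_power \<tau> 2) < 1"
  by (simp add: nome_power_def)

text \<open>The exponent is \<open>(m + 1/2)^2 = 1/4 + 2 * (m (m + 1) / 2)\<close>.\<close>

lemma nome_power_split:
  "nome_power \<tau> ((of_nat m + 1 / 2)\<^sup>2) = nome_power \<tau> (1 / 4) * nome_power \<tau> 2 ^ (\<Sum>{..m})"
proof (induction m)
  case 0
  show ?case by (simp add: power2_eq_square)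
next
  case (Suc m)
  have "nome_power \<tau> ((of_nat (Suc m) + 1 / 2)\<^sup>2) =
     nome_power \<tau> ((of_nat m + 1 / 2)\<^sup>2) * nome_power \<tau> 2 ^ Suc m"
    unfolding nome_power_def exp_of_nat_mult[symmetric] exp_add[symmetric]
    by (rule arg_cong[where f = exp]) (simp add: field_simps power2_eq_square)
  then show ?case using Suc.IH by (simp only: sum.atMost_Suc power_add mult.assoc)
qed

lemma norm_odd: "norm (2 * of_nat m + 1 :: complex) = 2 * real m + 1"
proof -
  have "2 * of_nat m + 1 = (of_nat (2 * m + 1) :: complex)" by simp
  then have "norm (2 * of_nat m + 1 :: complex) = real (2 * m + 1)" by (simp only: norm_of_nat)
  then show ?thesis by simp
qed

lemma norm_odd_multiple_sin_cos:
  fixes z :: complex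
  shows "norm (sin ((2 * of_nat m + 1) * z)) \<le> exp ((2 * real m + 1) * norm z)"
    and "norm (cos ((2 * of_nat m + 1) * z)) \<le> exp ((2 * real m + 1) * norm z)"
proof -
  have c: "(2 * of_nat m + 1 :: complex) = of_real (2 * real m + 1)" by simp
  have "\<bar>(2 * real m + 1) * Im z\<bar> \<le> (2 * real m + 1) * norm z"
    using abs_Im_le_cmod[of z] by (simp add: abs_mult mult_left_mono)
  then have e: "exp \<bar>(2 * real m + 1) * Im z\<bar> \<le> exp ((2 * real m + 1) * norm z)" by simp
  show "norm (sin ((2 * of_nat m + 1) * z)) \<le> exp ((2 * real m + 1) * norm z)"
    using cmod_sin_le_exp[of 1 "(2 * of_nat m + 1) * z"] e unfolding c by (simp del: of_real_add of_real_mult exp_le_cancel_iff)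
  show "norm (cos ((2 * of_nat m + 1) * z)) \<le> exp ((2 * real m + 1) * norm z)"
    using cmod_cos_le_exp[of 1 "(2 * of_nat m + 1) * z"] e unfolding c by (simp del: of_real_add of_real_mult exp_le_cancel_iff)
qed

lemma theta1_eq:
  assumes "Im \<tau> > 0"
  shows "theta1 z \<tau> = 2 * nome_power \<tau> (1 / 4) *
    (\<Sum>m. (-1) ^ m * nome_power \<tau> 2 ^ (\<Sum>{..m}) * sin ((2 * of_nat m + 1) * z))"
proof -
  let ?p = "nome_power \<tau> 2"
  have "norm (sin ((2 * of_nat m + 1) * z)) \<le> (2 * real m + 1) * exp ((2 * real m + 1) * norm z)" for m
    by (rule order.trans[OF norm_odd_multiple_sin_cos(1)]) simp
  then have "summable (\<lambda>m. (-1) ^ m * ?p ^ (\<Sum>{..m}) * sin ((2 * of_nat m + 1) * z))"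
    by (intro summable_comparison_test'[OF summable_theta_majorant[of "norm ?p" "norm z"], of 0])
       (auto simp: norm_mult norm_power norm_nome_less_1 assms intro!: mult_left_mono)
  from suminf_mult[OF this, of "nome_power \<tau> (1 / 4)"] show ?thesis
    by (simp add: theta1_def nome_power_split mult_ac)
qed

lemma theta1_has_field_derivative:
  assumes "Im \<tau> > 0"
  shows "((\<lambda>z. theta1 z \<tau>) has_field_derivative 2 * nome_power \<tau> (1 / 4) *
    (\<Sum>m. (-1) ^ m * nome_power \<tau> 2 ^ (\<Sum>{..m}) * ((2 * of_nat m + 1) * cos ((2 * of_nat m + 1) * z)))) (at z)"
proof -
  \<comment> \<open>The ball of this radius contains both \<open>z\<close> and the base point 0; the
    differentiated series converges uniformly on it.\<close>
  let ?p = "nome_power \<tau> 2" and ?R = "norm z + 1"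
  have S: "z \<in> ball 0 ?R" "0 < ?R" using norm_ge_zero[of z] by (simp, linarith)
  have "((\<lambda>z. \<Sum>m. (-1) ^ m * ?p ^ (\<Sum>{..m}) * sin ((2 * of_nat m + 1) * z)) has_field_derivative
     (\<Sum>m. (-1) ^ m * ?p ^ (\<Sum>{..m}) * ((2 * of_nat m + 1) * cos ((2 * of_nat m + 1) * z)))) (at z)"
  proof (rule has_field_derivative_series'(2)[where S = "ball 0 ?R" and ?x0.0 = 0])
    show "((\<lambda>z. (-1) ^ m * ?p ^ (\<Sum>{..m}) * sin ((2 * of_nat m + 1) * z)) has_field_derivative
        (-1) ^ m * ?p ^ (\<Sum>{..m}) * ((2 * of_nat m + 1) * cos ((2 * of_nat m + 1) * x))) (at x within ball 0 ?R)" for m x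
      by (auto intro!: derivative_eq_intros simp: mult_ac)
    show "uniformly_convergent_on (ball 0 ?R)
       (\<lambda>n x. \<Sum>m<n. (-1) ^ m * ?p ^ (\<Sum>{..m}) * ((2 * of_nat m + 1) * cos ((2 * of_nat m + 1) * x)))"
    proof (rule Weierstrass_m_test'[OF _ summable_theta_majorant[of "norm ?p" ?R]])
      fix m and x :: complex assume "x \<in> ball 0 ?R"
      then have "norm (cos ((2 * of_nat m + 1) * x)) \<le> exp ((2 * real m + 1) * ?R)"
        by (intro order.trans[OF norm_odd_multiple_sin_cos(2)]) (auto intro!: mult_left_mono)
      moreover have "norm (2 * of_nat m + 1 :: complex) = 2 * real m + 1"
        by (rule norm_odd)
      ultimately show "norm ((-1) ^ m * ?p ^ (\<Sum>{..m}) * ((2 * of_nat m + 1) * cos ((2 * of_nat m + 1) * x)))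
         \<le> norm ?p ^ (\<Sum>{..m}) * ((2 * real m + 1) * exp ((2 * real m + 1) * ?R))"
        by (auto simp: norm_mult norm_power intro!: mult_left_mono)
    qed (auto simp: norm_nome_less_1 assms)
  qed (use S in \<open>auto simp: interior_open\<close>)
  from DERIV_cmult[OF this] show ?thesis
    unfolding theta1_eq[OF assms, abs_def] .
qed

lemma theta1_field_differentiable:
  "Im \<tau> > 0 \<Longrightarrow> (\<lambda>z. theta1 z \<tau>) field_differentiable at z"
  unfolding field_differentiable_def using theta1_has_field_derivative by (rule exI)

lemma theta1_0: "theta1 0 \<tau> = 0"
  by (simp add: theta1_def)

text \<open>The derivative limit comes from the sequence \<open>s m = 2 m + 1\<close>, which avoids
  interchanging the limit with differentiation.\<close>

lemma theta1_product:
  assumes "Im \<tau> > 0"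
  defines "p \<equiv> nome_power \<tau> 2"
  obtains A where "A \<noteq> 0"
    "\<And>z. (\<lambda>N. sin z * (\<Prod>j<N. 1 - p ^ Suc j * (2 * cos (2 * z)) + p ^ (2 * Suc j))) \<longlonglongrightarrow> A * theta1 z \<tau>"
    "(\<lambda>N. \<Prod>j<N. 1 - p ^ Suc j * 2 + p ^ (2 * Suc j)) \<longlonglongrightarrow> A * theta1_deriv0 \<tau>"
proof -
  have p: "norm p < 1" using norm_nome_less_1[OF assms(1)] by (simp add: p_def)
  obtain K where K: "K \<noteq> 0" "qpoch p \<longlonglongrightarrow> K"
    using prod_one_minus_power_limit_nonzero[OF p norm_one] unfolding qpoch_def by auto
  define A where "A = 1 / (2 * nome_power \<tau> (1 / 4) * K)"
  show thesis
  proof (rule that[of A])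
    show "A \<noteq> 0" using K by (simp add: A_def nome_power_def)
  next
    fix z :: complex
    define s where "s m = sin ((2 * of_nat m + 1) * z)" for m
    have three: "2 * cos (2 * z) * sin w = sin (w + 2 * z) + sin (w - 2 * z)" for w
      by (simp add: sin_add sin_diff)
    have "2 * cos (2 * z) * s 0 = s 1 - s 0"
    proof -
      have "sin (z - 2 * z) = - sin z" by (metis add_diff_cancel_right' diff_minus_eq_add mult_2 minus_diff_eq sin_minus)
      then show ?thesis using three[of z] by (simp add: s_def algebra_simps)
    qed
    moreover have "2 * cos (2 * z) * s (Suc m) = s (Suc (Suc m)) + s m" for m
      using three[of "(2 * of_nat (Suc m) + 1) * z"] by (simp add: s_def algebra_simps)
    moreover have "norm (s m) \<le> (2 * real m + 1) * exp ((2 * real m + 1) * norm z)" for m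
      unfolding s_def by (rule order.trans[OF norm_odd_multiple_sin_cos(1)]) simp
    ultimately have "(\<lambda>N. s 0 * (\<Prod>j<N. 1 - p ^ Suc j * (2 * cos (2 * z)) + p ^ (2 * Suc j)))
           \<longlonglongrightarrow> (\<Sum>m. (-1) ^ m * p ^ (\<Sum>{..m}) * s m) / K"
      by (rule triple_product_limit[OF p K])
    then show "(\<lambda>N. sin z * (\<Prod>j<N. 1 - p ^ Suc j * (2 * cos (2 * z)) + p ^ (2 * Suc j)))
         \<longlonglongrightarrow> A * theta1 z \<tau>"
      unfolding theta1_eq[OF assms(1)] by (simp add: s_def A_def p_def nome_power_def)
  next
    define s :: "nat \<Rightarrow> complex" where "s m = 2 * of_nat m + 1" for m
    have n: "norm (s m) = 2 * real m + 1" for m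
      unfolding s_def by (rule norm_odd)
    have "(\<lambda>N. s 0 * (\<Prod>j<N. 1 - p ^ Suc j * 2 + p ^ (2 * Suc j)))
           \<longlonglongrightarrow> (\<Sum>m. (-1) ^ m * p ^ (\<Sum>{..m}) * s m) / K"
    proof (rule triple_product_limit[OF p K])
      show "norm (s m) \<le> (2 * real m + 1) * exp ((2 * real m + 1) * 0)" for m
        by (simp add: n)
    qed (simp_all add: s_def)
    moreover have "theta1_deriv0 \<tau> = 2 * nome_power \<tau> (1 / 4) * (\<Sum>m. (-1) ^ m * p ^ (\<Sum>{..m}) * s m)"
      using DERIV_imp_deriv[OF theta1_has_field_derivative[OF assms(1), of 0]]
      by (simp add: theta1_deriv0_def s_def p_def)
    ultimately show "(\<lambda>N. \<Prod>j<N. 1 - p ^ Suc j * 2 + p ^ (2 * Suc j)) \<longlonglongrightarrow> A * theta1_deriv0 \<tau>"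
      by (simp add: s_def A_def nome_power_def)
  qed
qed

text \<open>For real \<open>x\<close> both exponentials in the factorization have norm 1, so no
  factor vanishes and the product converges absolutely.\<close>

lemma cos_factor_product_nonzero:
  fixes p :: complex and x :: real
  assumes p: "norm p < 1"
  obtains L where "L \<noteq> 0"
    "(\<lambda>N. \<Prod>j<N. 1 - p ^ Suc j * (2 * cos (2 * of_real x)) + p ^ (2 * Suc j)) \<longlonglongrightarrow> L"
proof -
  have "norm (exp (2 * \<i> * of_real x)) = 1" "norm (exp (- (2 * \<i> * of_real x))) = 1"
    by (simp_all add: norm_exp_eq_Re)
  then obtain L1 L2 where "L1 \<noteq> 0" "L2 \<noteq> 0"
    "(\<lambda>N. \<Prod>j<N. 1 - p ^ Suc j * exp (2 * \<i> * of_real x)) \<longlonglongrightarrow> L1"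
    "(\<lambda>N. \<Prod>j<N. 1 - p ^ Suc j * exp (- (2 * \<i> * of_real x))) \<longlonglongrightarrow> L2"
    using prod_one_minus_power_limit_nonzero[OF p] by metis
  then have "L1 * L2 \<noteq> 0"
    "(\<lambda>N. \<Prod>j<N. (1 - p ^ Suc j * exp (2 * \<i> * of_real x)) * (1 - p ^ Suc j * exp (- (2 * \<i> * of_real x))))
      \<longlonglongrightarrow> L1 * L2"
    unfolding prod.distrib by (auto intro: tendsto_mult)
  moreover have "p ^ (2 * Suc j) = (p ^ Suc j) ^ 2" for j
    by (simp only: power_mult[symmetric] mult.commute)
  ultimately show ?thesis
    by (intro that[of "L1 * L2"]) (simp_all only: power_one_minus_cos not_False_eq_True)
qed

lemma theta1_real_nonzero:
  assumes "Im \<tau> > 0" "sin x \<noteq> 0"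
  shows "theta1 (of_real x) \<tau> \<noteq> 0"
proof -
  let ?p = "nome_power \<tau> 2"
  obtain A where A: "A \<noteq> 0"
    "\<And>z. (\<lambda>N. sin z * (\<Prod>j<N. 1 - ?p ^ Suc j * (2 * cos (2 * z)) + ?p ^ (2 * Suc j))) \<longlonglongrightarrow> A * theta1 z \<tau>"
    "(\<lambda>N. \<Prod>j<N. 1 - ?p ^ Suc j * 2 + ?p ^ (2 * Suc j)) \<longlonglongrightarrow> A * theta1_deriv0 \<tau>"
    by (rule theta1_product[OF assms(1)]) blast
  obtain L where L: "L \<noteq> 0"
    "(\<lambda>N. \<Prod>j<N. 1 - ?p ^ Suc j * (2 * cos (2 * of_real x)) + ?p ^ (2 * Suc j)) \<longlonglongrightarrow> L"
    by (rule cos_factor_product_nonzero[OF norm_nome_less_1[OF assms(1)]])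
  have "A * theta1 (of_real x) \<tau> = sin (of_real x) * L"
    using LIMSEQ_unique[OF A(2) tendsto_mult_left[OF L(2)]] .
  moreover have "sin (of_real x :: complex) \<noteq> 0"
    using assms(2) by (simp add: sin_of_real)
  ultimately show ?thesis using L(1) by auto
qed

lemma theta1_deriv0_nonzero:
  assumes "Im \<tau> > 0"
  shows "theta1_deriv0 \<tau> \<noteq> 0"
proof -
  let ?p = "nome_power \<tau> 2"
  obtain A where A: "A \<noteq> 0"
    "\<And>z. (\<lambda>N. sin z * (\<Prod>j<N. 1 - ?p ^ Suc j * (2 * cos (2 * z)) + ?p ^ (2 * Suc j))) \<longlonglongrightarrow> A * theta1 z \<tau>"
    "(\<lambda>N. \<Prod>j<N. 1 - ?p ^ Suc j * 2 + ?p ^ (2 * Suc j)) \<longlonglongrightarrow> A * theta1_deriv0 \<tau>"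
    by (rule theta1_product[OF assms(1)]) blast
  obtain L where L: "L \<noteq> 0"
    "(\<lambda>N. \<Prod>j<N. 1 - ?p ^ Suc j * (2 * cos (2 * of_real 0)) + ?p ^ (2 * Suc j)) \<longlonglongrightarrow> L"
    by (rule cos_factor_product_nonzero[OF norm_nome_less_1[OF assms(1)]])
  \<comment> \<open>At \<open>x = 0\<close> the cosine product is the one that represents the
    derivative.\<close>
  have "2 * cos (2 * of_real 0) = (2 :: complex)" by simp
  from LIMSEQ_unique[OF A(3) L(2)[unfolded this]] have "A * theta1_deriv0 \<tau> = L" .
  then show ?thesis using L(1) by auto
qed

subsection \<open>Multiplication of the argument\<close>

lemma exp_shift_root:
  fixes z :: complex
  assumes "n > 0"
  shows "exp (2 * \<i> * (z + of_nat k * of_real pi / of_nat n))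
       = exp (2 * \<i> * z) * exp (2 * of_real pi * \<i> * of_nat k / of_nat n)"
  by (simp add: algebra_simps flip: exp_add)

text \<open>Conjugation turns the inverse roots of unity into the roots themselves, so
  \<open>prod_minus_roots_unity\<close> applies.\<close>

lemma prod_one_minus_exp_shift:
  fixes a z :: complex
  assumes "n > 0" 
  shows "(\<Prod>k<n. 1 - a * exp (- (2 * \<i> * (z + of_nat k * of_real pi / of_nat n))))
       = 1 - a ^ n * exp (- (2 * \<i> * (of_nat n * z)))"
proof -
  let ?w = "\<lambda>k. exp (2 * of_real pi * \<i> * of_nat k / of_nat n)"
  have e: "exp (- (2 * \<i> * (z + of_nat k * of_real pi / of_nat n))) = cnj (exp (2 * \<i> * cnj z) * ?w k)" for k
    by (simp add: algebra_simps exp_cnj flip: exp_add)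
  have "(\<Prod>k<n. 1 - a * exp (- (2 * \<i> * (z + of_nat k * of_real pi / of_nat n))))
     = cnj (\<Prod>k<n. 1 - (cnj a * exp (2 * \<i> * cnj z)) * ?w k)"
    unfolding e by (simp add: mult.assoc)
  also have "\<dots> = cnj (1 ^ n - (cnj a * exp (2 * \<i> * cnj z)) ^ n)"
    by (simp only: prod_minus_roots_unity[OF assms])
  also have "\<dots> = 1 - a ^ n * exp (- (2 * \<i> * (of_nat n * z)))"
    by (simp add: power_mult_distrib exp_cnj mult_ac flip: exp_of_nat_mult)
  finally show ?thesis .
qed

lemma prod_cos_factor_shift:
  fixes a z :: complex
  assumes "n > 0"
  shows "(\<Prod>k<n. 1 - a * (2 * cos (2 * (z + of_nat k * of_real pi / of_nat n))) + a ^ 2)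
       = 1 - a ^ n * (2 * cos (2 * (of_nat n * z))) + (a ^ n) ^ 2"
proof -
  have "(\<Prod>k<n. 1 - a * exp (2 * \<i> * (z + of_nat k * of_real pi / of_nat n)))
      = 1 - a ^ n * exp (2 * \<i> * (of_nat n * z))"
    using prod_minus_roots_unity[OF assms, of 1 "a * exp (2 * \<i> * z)"]
    by (simp only: exp_shift_root[OF assms] mult.assoc[symmetric])
       (simp add: power_mult_distrib mult_ac flip: exp_of_nat_mult)
  then show ?thesis
    by (simp only: power_one_minus_cos prod.distrib prod_one_minus_exp_shift[OF assms])
qed

text \<open>Writing \<open>sin u\<close> as \<open>exp (i u) (1 - exp (- 2 i u)) / (2 i)\<close>
  gives the previous root-of-unity product with \<open>a = 1\<close>. The constant can stay
  inexplicit, since derivatives at 0 later fix the total constant.\<close>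

lemma prod_sin_shift:
  assumes "n > 0"
  obtains c :: complex where
    "\<And>z. sin (of_nat n * z) = c * (\<Prod>k<n. sin (z + of_nat k * of_real pi / of_nat n))"
proof
  fix z :: complex
  let ?e = "\<lambda>k. exp (\<i> * (of_nat k * of_real pi / of_nat n))"
  define d where "d = (\<Prod>k<n. ?e k / (2 * \<i>))"
  have d: "d \<noteq> 0" by (simp add: d_def prod_zero_iff)
  have sin: "sin u = exp (\<i> * u) * (1 - exp (- (2 * \<i> * u))) / (2 * \<i>)" for u :: complex
    by (simp add: sin_exp_eq right_diff_distrib flip: exp_add)
  have "sin (z + of_nat k * of_real pi / of_nat n) = exp (\<i> * z) * (?e k / (2 * \<i>)) *
     (1 - 1 * exp (- (2 * \<i> * (z + of_nat k * of_real pi / of_nat n))))" for k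
    unfolding sin distrib_left exp_add by simp
  then have "(\<Prod>k<n. sin (z + of_nat k * of_real pi / of_nat n))
     = exp (\<i> * z) ^ n * d * (1 - 1 ^ n * exp (- (2 * \<i> * (of_nat n * z))))"
    unfolding d_def by (simp only: prod.distrib prod_one_minus_exp_shift[OF assms] prod_constant card_lessThan)
  also have "\<dots> = d * (2 * \<i>) * sin (of_nat n * z)"
    unfolding sin[of "of_nat n * z"] by (simp add: mult_ac flip: exp_of_nat_mult)
  finally show "sin (of_nat n * z) = 1 / (d * (2 * \<i>)) * (\<Prod>k<n. sin (z + of_nat k * of_real pi / of_nat n))"
    using d by simp
qed

lemma theta1_multiple_proportional:
  assumes "Im \<tau> > 0" "n > 0"
  obtains C where "\<And>z. theta1 (of_nat n * z) (of_nat n * \<tau>)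
     = C * (\<Prod>k<n. theta1 (z + of_nat k * of_real pi / of_nat n) \<tau>)"
proof -
  define p where "p = nome_power \<tau> 2"
  have pn: "nome_power (of_nat n * \<tau>) 2 = p ^ n"
    unfolding p_def nome_power_def by (simp add: mult_ac flip: exp_of_nat_mult)
  have n\<tau>: "Im (of_nat n * \<tau>) > 0" using assms by simp
  define P where "P p z N = sin z * (\<Prod>j<N. 1 - p ^ Suc j * (2 * cos (2 * z)) + p ^ (2 * Suc j))"
    for p z :: complex and N
  let ?p = "nome_power \<tau> 2"
  obtain A where A0: "A \<noteq> 0"
    "\<And>z. (\<lambda>N. sin z * (\<Prod>j<N. 1 - ?p ^ Suc j * (2 * cos (2 * z)) + ?p ^ (2 * Suc j))) \<longlonglongrightarrow> A * theta1 z \<tau>"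
    "(\<lambda>N. \<Prod>j<N. 1 - ?p ^ Suc j * 2 + ?p ^ (2 * Suc j)) \<longlonglongrightarrow> A * theta1_deriv0 \<tau>"
    by (rule theta1_product[OF assms(1)]) blast
  have A: "(\<lambda>N. P p w N) \<longlonglongrightarrow> A * theta1 w \<tau>" for w
    using A0(2)[of w] by (simp only: P_def p_def)
  let ?p' = "nome_power (of_nat n * \<tau>) 2"
  obtain A' where A1: "A' \<noteq> 0"
    "\<And>z. (\<lambda>N. sin z * (\<Prod>j<N. 1 - ?p' ^ Suc j * (2 * cos (2 * z)) + ?p' ^ (2 * Suc j))) \<longlonglongrightarrow> A' * theta1 z (of_nat n * \<tau>)"
    "(\<lambda>N. \<Prod>j<N. 1 - ?p' ^ Suc j * 2 + ?p' ^ (2 * Suc j)) \<longlonglongrightarrow> A' * theta1_deriv0 (of_nat n * \<tau>)"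
    by (rule theta1_product[OF n\<tau>]) blast
  have A': "(\<lambda>N. P (p ^ n) w N) \<longlonglongrightarrow> A' * theta1 w (of_nat n * \<tau>)" for w
    using A1(2)[of w] by (simp only: P_def pn)
  obtain c :: complex where c: "\<And>z. sin (of_nat n * z) = c * (\<Prod>k<n. sin (z + of_nat k * of_real pi / of_nat n))"
    using prod_sin_shift[OF assms(2)] by blast
  have sq: "q ^ (2 * m) = (q ^ m) ^ 2" for q :: complex and m
    by (simp only: power_mult[symmetric] mult.commute)
  \<comment> \<open>The proportionality holds exactly for every truncation \<open>N\<close>, with
    \<open>c\<close> independent of \<open>N\<close> and \<open>z\<close>, so only limits of
    finitely many factors remain.\<close>
  have fin: "P (p ^ n) (of_nat n * z) N = c * (\<Prod>k<n. P p (z + of_nat k * of_real pi / of_nat n) N)" for z N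
  proof -
    have "(p ^ n) ^ Suc j = (p ^ Suc j) ^ n" for j
      by (simp only: power_mult[symmetric] mult.commute)
    then have "P (p ^ n) (of_nat n * z) N = c * (\<Prod>k<n. sin (z + of_nat k * of_real pi / of_nat n)) *
       (\<Prod>j<N. \<Prod>k<n. 1 - p ^ Suc j * (2 * cos (2 * (z + of_nat k * of_real pi / of_nat n))) + (p ^ Suc j) ^ 2)"
      unfolding P_def c sq prod_cos_factor_shift[OF assms(2)] by (simp only:)
    then show ?thesis
      unfolding P_def sq prod.distrib by (subst (asm) prod.swap) (simp only: mult.assoc)
  qed
  have "A' * theta1 (of_nat n * z) (of_nat n * \<tau>)
      = c * (\<Prod>k<n. A * theta1 (z + of_nat k * of_real pi / of_nat n) \<tau>)" for z
  proof (rule LIMSEQ_unique[OF A'])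
    show "(\<lambda>N. P (p ^ n) (of_nat n * z) N) \<longlonglongrightarrow> c * (\<Prod>k<n. A * theta1 (z + of_nat k * of_real pi / of_nat n) \<tau>)"
      unfolding fin by (intro tendsto_intros A)
  qed
  then show ?thesis
    using A1(1) by (intro that[of "c * A ^ n / A'"]) (simp add: prod.distrib field_simps)
qed

section \<open>Determination of the constant from derivatives at the origin\<close>

theorem mainTheorem5:
  fixes \<tau> z :: complex and n :: nat
  assumes "Im \<tau> > 0" and "n \<ge> 2"
  shows "theta1 (of_nat n * z) (of_nat n * \<tau>) =
      of_nat n * theta1_deriv0 (of_nat n * \<tau>) /
        (theta1_deriv0 \<tau> * (\<Prod>k=1..n-1. theta1 (of_nat k * of_real pi / of_nat n) \<tau>))
      * (\<Prod>k=0..n-1. theta1 (z + of_nat k * of_real pi / of_nat n) \<tau>)"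
proof -
  have n\<tau>: "Im (of_nat n * \<tau>) > 0" and n: "n > 0" using assms by simp_all
  \<comment> \<open>Only the factor with \<open>k = 0\<close> vanishes at the origin;
    \<open>R\<close> collects the others.\<close>
  define R where "R w = (\<Prod>k=1..n-1. theta1 (w + of_nat k * of_real pi / of_nat n) \<tau>)" for w
  have split: "(\<Prod>k=0..n-1. theta1 (w + of_nat k * of_real pi / of_nat n) \<tau>) = theta1 w \<tau> * R w" for w
    by (subst prod.atLeast_Suc_atMost) (simp_all add: R_def)
  obtain C where "\<And>w. theta1 (of_nat n * w) (of_nat n * \<tau>)
      = C * (\<Prod>k<n. theta1 (w + of_nat k * of_real pi / of_nat n) \<tau>)"
    by (rule theta1_multiple_proportional[OF assms(1) n]) blast
  moreover have "{..<n} = {0..n-1}" using n by auto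
  ultimately have C: "theta1 (of_nat n * w) (of_nat n * \<tau>) = C * (theta1 w \<tau> * R w)" for w
    by (simp only: split)
  have deriv: "((\<lambda>w. theta1 w \<sigma>) has_field_derivative theta1_deriv0 \<sigma>) (at 0)" if "Im \<sigma> > 0" for \<sigma>
    unfolding theta1_deriv0_def
    by (rule field_differentiable_derivI[OF theta1_field_differentiable[OF that]])
  have "((\<lambda>w. theta1 (of_nat n * w) (of_nat n * \<tau>)) has_field_derivative
      theta1_deriv0 (of_nat n * \<tau>) * of_nat n) (at 0)"
    by (rule DERIV_chain2[where g = "\<lambda>w. of_nat n * w"])
       (use deriv[OF n\<tau>] in \<open>auto intro!: derivative_eq_intros\<close>)
  moreover obtain R' where "(R has_field_derivative R') (at 0)"
  proof -
    have "(\<lambda>w. theta1 (w + a) \<tau>) field_differentiable at w" for a w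
      using theta1_field_differentiable[OF assms(1), of "w + a"]
        field_differentiable_compose[of "\<lambda>w. w + a" w "\<lambda>w. theta1 w \<tau>"]
      by (simp add: o_def field_differentiable_add)
    then have "(\<lambda>w. theta1 (w + a) \<tau>) holomorphic_on UNIV" for a
      by (simp add: holomorphic_on_def)
    then have "R holomorphic_on UNIV"
      unfolding R_def by (intro holomorphic_on_prod)
    then have "R field_differentiable at 0"
      by (auto intro: holomorphic_on_imp_differentiable_at)
    then show ?thesis using that by (auto simp: field_differentiable_def)
  qed
  \<comment> \<open>In the product rule the term with \<open>R'\<close> drops out because
    \<open>theta1 0 \<tau> = 0\<close>.\<close>
  then have "((\<lambda>w. C * (theta1 w \<tau> * R w)) has_field_derivative C * (theta1_deriv0 \<tau> * R 0)) (at 0)"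
    using deriv[OF assms(1)] by (auto intro!: derivative_eq_intros simp: theta1_0)
  ultimately have eq: "theta1_deriv0 (of_nat n * \<tau>) * of_nat n = C * (theta1_deriv0 \<tau> * R 0)"
    unfolding C by (rule DERIV_unique)
  have "theta1 (of_nat k * of_real pi / of_nat n) \<tau> \<noteq> 0" if "k \<in> {1..n-1}" for k
  proof -
    \<comment> \<open>The shifts lie strictly between 0 and pi, where the sine is positive.\<close>
    have "0 < real k * pi / real n" "real k * pi / real n < pi"
      using that n by (auto simp: field_simps)
    then have "sin (real k * pi / real n) \<noteq> 0" using sin_gt_zero by fastforce
    from theta1_real_nonzero[OF assms(1) this] show ?thesis by simp
  qed
  then have "R 0 \<noteq> 0" by (auto simp: R_def prod_zero_iff)
  then have "C = of_nat n * theta1_deriv0 (of_nat n * \<tau>) / (theta1_deriv0 \<tau> * R 0)"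
    using eq theta1_deriv0_nonzero[OF assms(1)] by (simp add: field_simps)
  moreover have "R 0 = (\<Prod>k=1..n-1. theta1 (of_nat k * of_real pi / of_nat n) \<tau>)"
    by (simp add: R_def)
  ultimately show ?thesis unfolding split C by simp
qed

end
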